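(* Let $B$ be a content $S$-semialgebra over a semiring $S$. Then the following statements hold: (1) if $S$ has very few zero-divisors, then $B$ has very few zero-divisors as well; (2) if $S$ is a weak Gaussian semiring and $B$ has very few zero-divisors, then $S$ has very few zero-divisors.
   Context: A semiring $(S,+,\cdot,0,1)$ is commutative: $(S,+,0)$ and $(S,\cdot,1)$ are commutative monoids, $1\neq 0$, multiplication distributes over addition, and $s\cdot 0=0$ for all $s$. An ideal is a nonempty subset closed under addition and under multiplication by elements of $S$; $\operatorname{Id}(S)$ is the set of ideals of $S$. A prime ideal is an ideal $P\neq S$ such that $ab\in P$ implies $a\in P$ or $b\in P$. $Z(S)$ is the set of zero-divisors: $s\in S$ with $ss'=0$ for some $s'\neq 0$ in $S$. $\operatorname{Ann}(a)=\{s\in S: as=0\}$; $\operatorname{Ass}(S)$ is the set of prime ideals of $S$ of the form $\operatorname{Ann}(a)$, $a\in S$. $S$ has very few zero-divisors if $Z(S)$ is a finite union of prime ideals in $\operatorname{Ass}(S)$. $S$ is weak Gaussian if for all $f,g\in S[X]$ one has $c(f)c(g)\subseteq\sqrt{c(fg)}$, where $c(f)$ for a polynomial $f$ is the ideal generated by its coefficients and $\sqrt{I}=\{s: s^n\in I\text{ for some positive integer }n\}$. An $S$-semialgebra is a semiring $B$ with a semiring homomorphism $\lambda:S\to B$ (preserving $+,\cdot,0,1$), with scalar product $sf=\lambda(s)f$; for an ideal $I$ of $S$, $IB=\{\sum_{i=1}^n a_if_i:a_i\in I,f_i\in B\}$. $B$ is a content $S$-semialgebra if $\lambda$ is injective (so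 $S\subseteq B$) and there is a function $c:B\to\operatorname{Id}(S)$ such that: (i) for all $f\in B$ and all ideals $I$ of $S$, $f\in IB$ iff $c(f)\subseteq I$; (ii) $c(sf)=s\,c(f)$ for all $s\in S$, $f\in B$, and $c(1)=S$; (iii) for all $f,g\in B$ there is an integer $m\ge 0$ with $c(f)^{m+1}c(g)=c(f)^mc(fg)$. Products of ideals are sets of finite sums of products, and $I^0=S$. *)

theory Defs
  imports "HOL-Computational_Algebra.Polynomial"
begin

text \<open>
  Semirings are the types of class \<open>comm_semiring_1\<close>, which includes
  \<open>0 * s = 0\<close> and \<open>0 \<noteq> 1\<close>. The ideals of the library are ideals of rings
  (closed under subtraction), so ideals of semirings are defined here.
\<close>

definition semiring_ideal :: "'a::comm_semiring_1 set \<Rightarrow> bool" where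
  "semiring_ideal I \<longleftrightarrow>
     I \<noteq> {} \<and> (\<forall>a\<in>I. \<forall>b\<in>I. a + b \<in> I) \<and> (\<forall>s. \<forall>a\<in>I. s * a \<in> I)"

definition semiring_prime_ideal :: "'a::comm_semiring_1 set \<Rightarrow> bool" where
  "semiring_prime_ideal P \<longleftrightarrow>
     semiring_ideal P \<and> P \<noteq> UNIV \<and> (\<forall>a b. a * b \<in> P \<longrightarrow> a \<in> P \<or> b \<in> P)"

definition ideal_generated :: "'a::comm_semiring_1 set \<Rightarrow> 'a set" where
  "ideal_generated A = semiring_ideal hull A"

definition ideal_mult :: "'a::comm_semiring_1 set \<Rightarrow> 'a set \<Rightarrow> 'a set" where
  "ideal_mult I J =
     {\<Sum>i<n. a i * b i | (n::nat) a b. \<forall>i<n. a i \<in> I \<and> b i \<in> J}"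

primrec ideal_power :: "'a::comm_semiring_1 set \<Rightarrow> nat \<Rightarrow> 'a set" where
  "ideal_power I 0 = UNIV"
| "ideal_power I (Suc n) = ideal_mult I (ideal_power I n)"

definition ideal_radical :: "'a::comm_semiring_1 set \<Rightarrow> 'a set" where
  "ideal_radical I = {s. \<exists>n>0. s ^ n \<in> I}"

definition zero_divisors :: "'a::comm_semiring_1 set" where
  "zero_divisors = {s. \<exists>t. t \<noteq> 0 \<and> s * t = 0}"

definition annihilator :: "'a::comm_semiring_1 \<Rightarrow> 'a set" where
  "annihilator a = {s. a * s = 0}"

definition associated_primes :: "'a::comm_semiring_1 set set" where
  "associated_primes = {P. semiring_prime_ideal P \<and> (\<exists>a. P = annihilator a)}"

definition very_few_zero_divisors :: "'a::comm_semiring_1 itself \<Rightarrow> bool" where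
  "very_few_zero_divisors T \<longleftrightarrow>
     (\<exists>F. finite F \<and> F \<subseteq> associated_primes \<and> (zero_divisors :: 'a set) = \<Union>F)"

definition poly_content_ideal :: "'a::comm_semiring_1 poly \<Rightarrow> 'a set" where
  "poly_content_ideal f = ideal_generated (set (coeffs f))"

definition weak_Gaussian :: "'a::comm_semiring_1 itself \<Rightarrow> bool" where
  "weak_Gaussian T \<longleftrightarrow>
     (\<forall>f g :: 'a poly. ideal_mult (poly_content_ideal f) (poly_content_ideal g)
                         \<subseteq> ideal_radical (poly_content_ideal (f * g)))"

definition semiring_homomorphism ::
    "('s::comm_semiring_1 \<Rightarrow> 'b::comm_semiring_1) \<Rightarrow> bool" where
  "semiring_homomorphism h \<longleftrightarrow>
     h 0 = 0 \<and> h 1 = 1 \<and>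
     (\<forall>x y. h (x + y) = h x + h y) \<and> (\<forall>x y. h (x * y) = h x * h y)"

text \<open>An \<open>S\<close>-semialgebra \<open>B\<close> is given by its structure map \<open>h\<close> from \<open>S\<close> to \<open>B\<close>; the scalar
  product of \<open>s\<close> and \<open>f\<close> is \<open>h s * f\<close>, and \<open>extended_ideal h I\<close> is \<open>IB\<close>.\<close>

definition extended_ideal ::
    "('s::comm_semiring_1 \<Rightarrow> 'b::comm_semiring_1) \<Rightarrow> 's set \<Rightarrow> 'b set" where
  "extended_ideal h I = {\<Sum>i<n. h (a i) * f i | (n::nat) a f. \<forall>i<n. a i \<in> I}"

definition content_function ::
    "('s::comm_semiring_1 \<Rightarrow> 'b::comm_semiring_1) \<Rightarrow> ('b \<Rightarrow> 's set) \<Rightarrow> bool" where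
  "content_function h c \<longleftrightarrow>
     (\<forall>f. semiring_ideal (c f)) \<and>
     (\<forall>f I. semiring_ideal I \<longrightarrow> (f \<in> extended_ideal h I \<longleftrightarrow> c f \<subseteq> I)) \<and>
     (\<forall>s f. c (h s * f) = (\<lambda>x. s * x) ` c f) \<and>
     c 1 = UNIV \<and>
     (\<forall>f g. \<exists>m. ideal_mult (ideal_power (c f) (m + 1)) (c g)
                = ideal_mult (ideal_power (c f) m) (c (f * g)))"

definition content_semialgebra ::
    "('s::comm_semiring_1 \<Rightarrow> 'b::comm_semiring_1) \<Rightarrow> bool" where
  "content_semialgebra h \<longleftrightarrow>
     semiring_homomorphism h \<and> inj h \<and> (\<exists>c. content_function h c)"

end

theory Submission
  imports Defs
begin

text \<open>
  Write \<open>S\<close> for the source and \<open>B\<close> for the target of the structure map \<open>h\<close>, and let \<open>c\<close> be a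
  content function. Everything rests on three consequences of the axioms for \<open>c\<close>.
  First, \<open>c f = 0\<close> only for \<open>f = 0\<close>; hence \<open>a f = 0\<close> in \<open>B\<close> holds if and only if
  \<open>c f \<subseteq> Ann(a)\<close> (\<open>scalar_mult_eq_0_iff\<close>). Second, the exponent formula gives: if \<open>Ann(a)\<close> is a
  prime ideal of \<open>S\<close>, then the annihilator of \<open>a\<close> in \<open>B\<close> is a prime ideal of \<open>B\<close>
  (\<open>associated_prime_extends\<close>). Third, it gives McCoy's property: the content of a zero-divisor of
  \<open>B\<close> is annihilated by a single nonzero element of \<open>S\<close> (\<open>McCoy\<close>).

  For the ascent, let \<open>Z(S)\<close> be the union of the primes \<open>Ann(a)\<close>, where \<open>a\<close> runs through a finite
  set. By McCoy's property the content of a zero-divisor \<open>f\<close> of \<open>B\<close> lies in this union. Prime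
  avoidance fails for semirings in general, since its proof subtracts, but it holds for ideals
  that are closed under the differences that exist, and annihilators are. So \<open>c f\<close> lies in one
  \<open>Ann(a)\<close>, that is, \<open>f\<close> annihilates \<open>a\<close>, and \<open>Z(B)\<close> is the union of the annihilators of the
  same elements \<open>a\<close> in \<open>B\<close>.

  For the descent, \<open>Z(S)\<close> is the contraction of \<open>Z(B)\<close>, hence the union of the contractions of
  finitely many primes \<open>Ann(f)\<close> with \<open>f \<in> B\<close>. Since \<open>f\<close> lies in the extension of its own content,
  it is a combination of finitely many \<open>a\<^sub>i \<in> c f\<close>, and the contraction of \<open>Ann(f)\<close> is the
  intersection of the \<open>Ann(a\<^sub>i)\<close>. A prime ideal that is a finite intersection of ideals is equal
  to one of them, so the contraction is an associated prime of \<open>S\<close> (\<open>associated_prime_contracts\<close>).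
\<close>

section \<open>Ideals and primes of semirings\<close>

lemma semiring_ideal_0:
  assumes "semiring_ideal I"
  shows "0 \<in> I"
proof -
  obtain a where "a \<in> I" using assms by (auto simp: semiring_ideal_def)
  then have "0 * a \<in> I" using assms unfolding semiring_ideal_def by blast
  then show ?thesis by simp
qed

lemma semiring_ideal_add:
  "semiring_ideal I \<Longrightarrow> a \<in> I \<Longrightarrow> b \<in> I \<Longrightarrow> a + b \<in> I"
  by (simp add: semiring_ideal_def)

lemma semiring_ideal_mult_left:
  "semiring_ideal I \<Longrightarrow> a \<in> I \<Longrightarrow> s * a \<in> I"
  by (simp add: semiring_ideal_def)

lemma semiring_ideal_prod:
  assumes "semiring_ideal I" "finite A" "x \<in> A" "f x \<in> I"
  shows "prod f A \<in> I"
proof -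
  have "prod f A = prod f (A - {x}) * f x"
    using prod.remove[OF assms(2,3), of f] by (simp add: mult.commute)
  then show ?thesis
    using semiring_ideal_mult_left[OF assms(1,4), of "prod f (A - {x})"] by simp
qed

lemma semiring_ideal_zero: "semiring_ideal {0}"
  by (simp add: semiring_ideal_def)

lemma semiring_prime_ideal_1:
  assumes "semiring_prime_ideal P"
  shows "1 \<notin> P"
proof
  assume "1 \<in> P"
  moreover have "semiring_ideal P" using assms by (simp add: semiring_prime_ideal_def)
  ultimately have "s \<in> P" for s
    using semiring_ideal_mult_left[of P 1 s] by simp
  then show False using assms by (auto simp: semiring_prime_ideal_def)
qed

lemma semiring_prime_ideal_multD:
  "semiring_prime_ideal P \<Longrightarrow> a * b \<in> P \<Longrightarrow> a \<in> P \<or> b \<in> P"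
  by (simp add: semiring_prime_ideal_def)

lemma semiring_prime_ideal_power:
  assumes "semiring_prime_ideal P" "a ^ n \<in> P"
  shows "a \<in> P"
  using assms(2)
proof (induction n)
  case 0
  then show ?case using semiring_prime_ideal_1[OF assms(1)] by simp
next
  case (Suc n)
  then show ?case using semiring_prime_ideal_multD[OF assms(1), of a "a ^ n"] by auto
qed

lemma semiring_prime_ideal_prod:
  assumes "semiring_prime_ideal P" "finite A" "prod f A \<in> P"
  shows "\<exists>x\<in>A. f x \<in> P"
  using assms(2,3)
proof (induction A)
  case empty
  then show ?case using semiring_prime_ideal_1[OF assms(1)] by simp
next
  case (insert x A)
  then show ?case using semiring_prime_ideal_multD[OF assms(1), of "f x" "prod f A"] by auto
qed

text \<open>
  The usual argument works once the primes are subtractive: in a minimal cover choose, for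
  each prime, an element of \<open>I\<close> that lies in this prime only. The sum of one of these elements and
  the product of all the others then lies in no prime of the cover.
\<close>
lemma subtractive_prime_avoidance:
  assumes "finite F" and I: "semiring_ideal I" and cover: "I \<subseteq> \<Union>F"
    and prime: "\<And>P. P \<in> F \<Longrightarrow> semiring_prime_ideal P"
    and subtractive: "\<And>P x y. P \<in> F \<Longrightarrow> x \<in> P \<Longrightarrow> x + y \<in> P \<Longrightarrow> y \<in> P"
  shows "\<exists>P\<in>F. I \<subseteq> P"
proof -
  have "\<exists>G. G \<subseteq> F \<and> I \<subseteq> \<Union>G \<and> (\<forall>H. H \<subset> G \<longrightarrow> \<not> I \<subseteq> \<Union>H)"
    using \<open>finite F\<close> cover
  proof (induction F rule: finite_psubset_induct)
    case (psubset F)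
    show ?case
    proof (cases "\<exists>H. H \<subset> F \<and> I \<subseteq> \<Union>H")
      case True
      then obtain H where "H \<subset> F" "I \<subseteq> \<Union>H" by blast
      with psubset.IH[of H] show ?thesis by (meson psubset_imp_subset subset_trans)
    next
      case False
      with psubset.prems show ?thesis by blast
    qed
  qed
  then obtain G where G: "G \<subseteq> F" "I \<subseteq> \<Union>G" and minimal: "\<And>H. H \<subset> G \<Longrightarrow> \<not> I \<subseteq> \<Union>H"
    by blast
  have "finite G" using G(1) \<open>finite F\<close> by (rule finite_subset)
  have "\<exists>x. x \<in> I \<and> x \<notin> \<Union>(G - {P})" if "P \<in> G" for P
    using minimal[of "G - {P}"] that by blast
  then obtain x where x: "\<And>P. P \<in> G \<Longrightarrow> x P \<in> I \<and> x P \<notin> \<Union>(G - {P})"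
    by metis
  have own: "x P \<in> P" if "P \<in> G" for P
    using x[OF that] G(2) by blast
  obtain P where P: "P \<in> G" using G(2) semiring_ideal_0[OF I] by blast
  have "G = {P}"
  proof (rule ccontr)
    assume "G \<noteq> {P}"
    then obtain Q where Q: "Q \<in> G - {P}" using P by blast
    let ?y = "\<Prod>Q\<in>G - {P}. x Q"
    have fin: "finite (G - {P})" using \<open>finite G\<close> by simp
    have "?y \<in> I" using semiring_ideal_prod[OF I fin Q] x Q by blast
    then have "x P + ?y \<in> I" using semiring_ideal_add[OF I] x P by blast
    then obtain R where R: "R \<in> G" "x P + ?y \<in> R" using G(2) by blast
    show False
    proof (cases "R = P")
      case True
      then have "?y \<in> P" using subtractive[of P "x P" ?y] R own[OF P] P G(1) by blast
      then obtain Q where "Q \<in> G - {P}" "x Q \<in> P"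
        using semiring_prime_ideal_prod[OF prime fin] P G(1) by blast
      then show False using x[of Q] P by blast
    next
      case False
      then have "R \<in> G - {P}" using R by blast
      moreover have "semiring_ideal R"
        using prime R(1) G(1) by (auto simp: semiring_prime_ideal_def)
      ultimately have "?y \<in> R" using semiring_ideal_prod[OF _ fin] own R(1) by blast
      then have "x P \<in> R" using subtractive[of R ?y "x P"] R G(1) by (auto simp: add.commute)
      then show False using x[OF P] \<open>R \<in> G - {P}\<close> by blast
    qed
  qed
  then show ?thesis using G by auto
qed

lemma annihilator_ideal: "semiring_ideal (annihilator a)"
proof -
  have "0 \<in> annihilator a" by (simp add: annihilator_def)
  then show ?thesis
    unfolding semiring_ideal_def
    by (auto simp: annihilator_def distrib_left mult.left_commute[of a] intro: exI[of _ 0])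
qed

lemma annihilator_subtractive:
  "x \<in> annihilator a \<Longrightarrow> x + y \<in> annihilator a \<Longrightarrow> y \<in> annihilator a"
  by (simp add: annihilator_def distrib_left)

lemma annihilator_prime_nonzero:
  "semiring_prime_ideal (annihilator a) \<Longrightarrow> a \<noteq> 0"
  by (auto simp: semiring_prime_ideal_def annihilator_def)

text \<open>
  If each ideal had an element outside the prime, the product of these elements would be in
  the intersection, hence in the prime.
\<close>
lemma prime_eq_finite_Inter:
  assumes "semiring_prime_ideal P" "finite A" "\<And>x. x \<in> A \<Longrightarrow> semiring_ideal (J x)"
    and eq: "P = (\<Inter>x\<in>A. J x)"
  shows "\<exists>x\<in>A. P = J x"
proof (rule ccontr)
  assume "\<not> ?thesis"
  then have "\<exists>y. y \<in> J x \<and> y \<notin> P" if "x \<in> A" for x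
    using that eq by blast
  then obtain y where y: "\<And>x. x \<in> A \<Longrightarrow> y x \<in> J x \<and> y x \<notin> P" by metis
  have "prod y A \<in> J x" if "x \<in> A" for x
    using semiring_ideal_prod[of "J x" A x y] assms(2,3) y that by blast
  then have "prod y A \<in> P" using eq by blast
  then show False using semiring_prime_ideal_prod[OF assms(1,2)] y by blast
qed

section \<open>Products and powers of ideals\<close>

lemma ideal_mult_memI:
  assumes "a \<in> I" "b \<in> J"
  shows "a * b \<in> ideal_mult I J"
  unfolding ideal_mult_def
  using assms by (intro CollectI exI[of _ "1::nat"] exI[of _ "\<lambda>_. a"] exI[of _ "\<lambda>_. b"]) simp

lemma ideal_mult_subset:
  assumes J: "semiring_ideal J"
  shows "ideal_mult I J \<subseteq> J"
proof
  fix z assume "z \<in> ideal_mult I J"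
  then obtain n :: nat and a b where z: "z = (\<Sum>i<n. a i * b i)" and ab: "\<forall>i<n. b i \<in> J"
    unfolding ideal_mult_def by blast
  have "(\<Sum>i<k. a i * b i) \<in> J" if "k \<le> n" for k
    using that
    by (induction k)
      (auto simp: semiring_ideal_0[OF J] ab
        intro!: semiring_ideal_add[OF J] semiring_ideal_mult_left[OF J])
  then show "z \<in> J" using z by blast
qed

lemma ideal_power_memI: "a \<in> I \<Longrightarrow> a ^ n \<in> ideal_power I n"
  by (induction n) (auto intro: ideal_mult_memI)

section \<open>Annihilators and zero-divisors in content semialgebras\<close>

locale content_map =
  fixes h :: "'s::comm_semiring_1 \<Rightarrow> 'b::comm_semiring_1" and c :: "'b \<Rightarrow> 's set"
  assumes hom: "semiring_homomorphism h" and inj: "inj h" and content: "content_function h c"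
begin

lemma h_0: "h 0 = 0" and h_1: "h 1 = 1" and h_mult: "h (x * y) = h x * h y"
  and h_add: "h (x + y) = h x + h y"
  using hom by (auto simp: semiring_homomorphism_def)

lemma h_eq_0_iff: "h x = 0 \<longleftrightarrow> x = 0"
  using inj_eq[OF inj, of x 0] by (simp add: h_0)

lemma content_ideal: "semiring_ideal (c f)"
  using content by (simp add: content_function_def)

lemma mem_extended_ideal_iff: "semiring_ideal I \<Longrightarrow> f \<in> extended_ideal h I \<longleftrightarrow> c f \<subseteq> I"
  using content unfolding content_function_def by blast

lemma content_scalar: "c (h s * f) = (\<lambda>x. s * x) ` c f"
  using content unfolding content_function_def by blast

lemma content_1: "c 1 = UNIV"
  using content unfolding content_function_def by blast

text \<open>This is the defining property of the content for the zero ideal, whose extension is zero.\<close>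
lemma content_subset_0_iff: "c f \<subseteq> {0} \<longleftrightarrow> f = 0"
proof -
  have "extended_ideal h {0} = {0}"
  proof
    show "extended_ideal h {0} \<subseteq> {0}"
      by (auto simp: extended_ideal_def h_0)
    show "{0} \<subseteq> extended_ideal h {0}"
      by (auto simp: extended_ideal_def intro: exI[of _ "0::nat"])
  qed
  then show ?thesis
    using mem_extended_ideal_iff[OF semiring_ideal_zero, of f] by simp
qed

lemma scalar_mult_eq_0_iff: "h a * f = 0 \<longleftrightarrow> c f \<subseteq> annihilator a"
  using content_subset_0_iff[of "h a * f"]
  by (auto simp: content_scalar annihilator_def)

text \<open>
  By the exponent formula, a prime that contains \<open>c (f * g)\<close> contains \<open>x\<^bsup>m+1\<^esup> y\<close> for all
  \<open>x \<in> c f\<close> and \<open>y \<in> c g\<close>.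
\<close>
lemma prime_content_mult:
  assumes P: "semiring_prime_ideal P" and "c (f * g) \<subseteq> P"
  shows "c f \<subseteq> P \<or> c g \<subseteq> P"
proof (rule ccontr)
  assume "\<not> ?thesis"
  then obtain x y where x: "x \<in> c f" "x \<notin> P" and y: "y \<in> c g" "y \<notin> P" by blast
  obtain m where m: "ideal_mult (ideal_power (c f) (m + 1)) (c g)
      = ideal_mult (ideal_power (c f) m) (c (f * g))"
    using content unfolding content_function_def by blast
  have "x ^ (m + 1) * y \<in> ideal_mult (ideal_power (c f) (m + 1)) (c g)"
    using x y by (intro ideal_mult_memI ideal_power_memI)
  also have "\<dots> \<subseteq> c (f * g)"
    unfolding m by (rule ideal_mult_subset[OF content_ideal])
  finally have "x ^ (m + 1) * y \<in> P" using assms(2) by blast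
  then show False
    using semiring_prime_ideal_multD[OF P] semiring_prime_ideal_power[OF P] x y by blast
qed

lemma associated_prime_extends:
  assumes P: "semiring_prime_ideal (annihilator a)"
  shows "semiring_prime_ideal (annihilator (h a))"
proof -
  have mem: "f \<in> annihilator (h a) \<longleftrightarrow> c f \<subseteq> annihilator a" for f
    using scalar_mult_eq_0_iff[of a f] by (simp add: annihilator_def)
  have "1 \<notin> annihilator (h a)"
    using P by (auto simp: mem content_1 semiring_prime_ideal_def)
  moreover have "f \<in> annihilator (h a) \<or> g \<in> annihilator (h a)"
    if "f * g \<in> annihilator (h a)" for f g
    using prime_content_mult[OF P, of f g] that by (simp add: mem)
  ultimately show ?thesis
    unfolding semiring_prime_ideal_def using annihilator_ideal by blast
qed

text \<open>
  If \<open>f * g = 0\<close>, some power of \<open>c f\<close> kills \<open>c g\<close>. For the least such exponent \<open>Suc j\<close>, any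
  nonzero product of an element of the \<open>j\<close>-th power and an element of \<open>c g\<close> kills \<open>c f\<close>.
\<close>
lemma McCoy:
  assumes "f \<in> zero_divisors"
  shows "\<exists>s. s \<noteq> 0 \<and> (\<forall>x\<in>c f. x * s = 0)"
proof -
  obtain g where g: "g \<noteq> 0" "f * g = 0"
    using assms by (auto simp: zero_divisors_def)
  define kills where "kills k \<longleftrightarrow> (\<forall>x\<in>ideal_power (c f) k. \<forall>y\<in>c g. x * y = 0)" for k
  obtain m where m: "ideal_mult (ideal_power (c f) (m + 1)) (c g)
      = ideal_mult (ideal_power (c f) m) (c (f * g))"
    using content unfolding content_function_def by blast
  have "ideal_mult (ideal_power (c f) (m + 1)) (c g) \<subseteq> c (f * g)"
    unfolding m by (rule ideal_mult_subset[OF content_ideal])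
  also have "\<dots> \<subseteq> {0}" using content_subset_0_iff[of "f * g"] g(2) by blast
  finally have "kills (m + 1)" unfolding kills_def using ideal_mult_memI by blast
  then obtain k where k: "kills k" and least: "\<And>j. j < k \<Longrightarrow> \<not> kills j"
    using exists_least_iff[of kills] by blast
  have "\<not> kills 0"
  proof
    assume "kills 0"
    then have "1 * y = 0" if "y \<in> c g" for y
      using that unfolding kills_def ideal_power.simps by blast
    then show False using content_subset_0_iff[of g] g(1) by auto
  qed
  then obtain j where j: "k = Suc j" using k by (cases k) auto
  then obtain x y where xy: "x \<in> ideal_power (c f) j" "y \<in> c g" "x * y \<noteq> 0"
    using least[of j] unfolding kills_def by auto
  have "z * (x * y) = 0" if "z \<in> c f" for z
  proof -
    have "z * x \<in> ideal_power (c f) k" using ideal_mult_memI[OF that xy(1)] by (simp add: j)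
    then have "(z * x) * y = 0" using k xy(2) unfolding kills_def by blast
    then show ?thesis by (simp add: mult.assoc)
  qed
  then show ?thesis using xy(3) by blast
qed

lemma zero_divisors_contract: "s \<in> zero_divisors \<longleftrightarrow> h s \<in> zero_divisors"
proof
  assume "s \<in> zero_divisors"
  then obtain t where "t \<noteq> 0" "s * t = 0" by (auto simp: zero_divisors_def)
  then have "h t \<noteq> 0" "h s * h t = 0" by (simp_all add: h_eq_0_iff h_0 flip: h_mult)
  then show "h s \<in> zero_divisors" by (auto simp: zero_divisors_def)
next
  assume "h s \<in> zero_divisors"
  then obtain g where g: "g \<noteq> 0" "h s * g = 0" by (auto simp: zero_divisors_def)
  then obtain t where "t \<in> c g" "t \<noteq> 0" using content_subset_0_iff[of g] by blast
  moreover have "s * t = 0"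
    using scalar_mult_eq_0_iff[of s g] g(2) \<open>t \<in> c g\<close> by (auto simp: annihilator_def)
  ultimately show "s \<in> zero_divisors" by (auto simp: zero_divisors_def)
qed

lemma prime_contracts:
  assumes Q: "semiring_prime_ideal Q"
  shows "semiring_prime_ideal (h -` Q)"
proof -
  have ideal: "semiring_ideal Q" using Q by (simp add: semiring_prime_ideal_def)
  have "0 \<in> h -` Q" using semiring_ideal_0[OF ideal] by (simp add: h_0)
  then have "semiring_ideal (h -` Q)"
    using ideal unfolding semiring_ideal_def by (auto simp: h_add h_mult)
  moreover have "1 \<notin> h -` Q" using semiring_prime_ideal_1[OF Q] by (simp add: h_1)
  ultimately show ?thesis
    using semiring_prime_ideal_multD[OF Q] unfolding semiring_prime_ideal_def
    by (metis UNIV_I h_mult vimage_eq)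
qed

lemma associated_prime_contracts:
  assumes "Q \<in> associated_primes"
  shows "h -` Q \<in> associated_primes"
proof -
  obtain f where f: "Q = annihilator f" and Q: "semiring_prime_ideal Q"
    using assms by (auto simp: associated_primes_def)
  have "f \<in> extended_ideal h (c f)"
    by (simp add: mem_extended_ideal_iff content_ideal)
  then obtain n :: nat and a g
    where fsum: "f = (\<Sum>i<n. h (a i) * g i)" and a: "\<forall>i<n. a i \<in> c f"
    unfolding extended_ideal_def by blast
  have eq: "h -` Q = (\<Inter>i\<in>{..<n}. annihilator (a i))"
  proof (intro set_eqI iffI)
    fix s assume "s \<in> h -` Q"
    then have "c f \<subseteq> annihilator s"
      using scalar_mult_eq_0_iff[of s f] by (simp add: f annihilator_def mult.commute)
    then show "s \<in> (\<Inter>i\<in>{..<n}. annihilator (a i))"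
      using a by (auto simp: annihilator_def mult.commute)
  next
    fix s assume s: "s \<in> (\<Inter>i\<in>{..<n}. annihilator (a i))"
    have "h (a i) * g i * h s = 0" if "i < n" for i
    proof -
      have "h (a i) * g i * h s = h (a i * s) * g i" by (simp add: h_mult ac_simps)
      then show ?thesis using s that by (auto simp: annihilator_def h_0)
    qed
    then have "f * h s = 0" unfolding fsum sum_distrib_right by simp
    then show "s \<in> h -` Q" by (simp add: f annihilator_def)
  qed
  have prime: "semiring_prime_ideal (h -` Q)" by (rule prime_contracts[OF Q])
  obtain i where "h -` Q = annihilator (a i)"
    using prime_eq_finite_Inter[OF prime finite_lessThan annihilator_ideal eq] by blast
  with prime show ?thesis unfolding associated_primes_def by blast
qed

section \<open>Very few zero-divisors\<close>

lemma very_few_zero_divisors_ascends: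
  assumes "very_few_zero_divisors TYPE('s)"
  shows "very_few_zero_divisors TYPE('b)"
proof -
  obtain F where F: "finite F" "F \<subseteq> associated_primes" "(zero_divisors :: 's set) = \<Union>F"
    using assms unfolding very_few_zero_divisors_def by blast
  have prime: "semiring_prime_ideal P" if "P \<in> F" for P
    using F(2) that by (auto simp: associated_primes_def)
  have "\<exists>a. P = annihilator a" if "P \<in> F" for P
    using F(2) that by (auto simp: associated_primes_def)
  then obtain a where a: "\<And>P. P \<in> F \<Longrightarrow> P = annihilator (a P)" by metis
  let ?G = "(\<lambda>P. annihilator (h (a P))) ` F"
  have "?G \<subseteq> associated_primes"
  proof
    fix Q assume "Q \<in> ?G"
    then obtain P where "P \<in> F" and Q: "Q = annihilator (h (a P))" by blast
    then have "semiring_prime_ideal (annihilator (a P))" using prime a by metis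
    then show "Q \<in> associated_primes"
      unfolding associated_primes_def Q using associated_prime_extends by blast
  qed
  moreover have "(zero_divisors :: 'b set) = \<Union>?G"
  proof (intro set_eqI iffI)
    fix f :: 'b assume "f \<in> zero_divisors"
    then have "c f \<subseteq> \<Union>F"
      using McCoy[of f] unfolding F(3)[symmetric] zero_divisors_def by blast
    moreover have "y \<in> P" if "P \<in> F" "x \<in> P" "x + y \<in> P" for P x y
      using annihilator_subtractive[of x "a P" y] that a by metis
    ultimately obtain P where P: "P \<in> F" "c f \<subseteq> P"
      using subtractive_prime_avoidance[OF F(1) content_ideal _ prime] by blast
    then have "c f \<subseteq> annihilator (a P)" using a by blast
    then have "f \<in> annihilator (h (a P))"
      using scalar_mult_eq_0_iff by (simp add: annihilator_def)
    then show "f \<in> \<Union>?G" using P by blast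
  next
    fix f :: 'b assume "f \<in> \<Union>?G"
    then obtain P where P: "P \<in> F" "f \<in> annihilator (h (a P))" by blast
    have "a P \<noteq> 0" using annihilator_prime_nonzero prime a P(1) by metis
    then have "h (a P) \<noteq> 0" by (simp add: h_eq_0_iff)
    moreover have "f * h (a P) = 0" using P(2) by (simp add: annihilator_def mult.commute)
    ultimately show "f \<in> zero_divisors" unfolding zero_divisors_def by blast
  qed
  ultimately show ?thesis
    unfolding very_few_zero_divisors_def using F(1) by blast
qed

lemma very_few_zero_divisors_descends:
  assumes "very_few_zero_divisors TYPE('b)"
  shows "very_few_zero_divisors TYPE('s)"
proof -
  obtain F where F: "finite F" "F \<subseteq> associated_primes" "(zero_divisors :: 'b set) = \<Union>F"
    using assms unfolding very_few_zero_divisors_def by blast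
  have "(\<lambda>Q. h -` Q) ` F \<subseteq> associated_primes"
    using F(2) associated_prime_contracts by blast
  moreover have "(zero_divisors :: 's set) = \<Union>((\<lambda>Q. h -` Q) ` F)"
    unfolding set_eq_iff zero_divisors_contract F(3) by blast
  ultimately show ?thesis
    unfolding very_few_zero_divisors_def using F(1) by blast
qed

end

theorem theorem50:
  fixes h :: "'s::comm_semiring_1 \<Rightarrow> 'b::comm_semiring_1"
  assumes "content_semialgebra h"
  shows "(very_few_zero_divisors TYPE('s) \<longrightarrow> very_few_zero_divisors TYPE('b)) \<and>
         (weak_Gaussian TYPE('s) \<and> very_few_zero_divisors TYPE('b)
            \<longrightarrow> very_few_zero_divisors TYPE('s))"
proof -
  obtain c where "content_function h c" "semiring_homomorphism h" "inj h"
    using assms by (auto simp: content_semialgebra_def)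
  then interpret content_map h c by unfold_locales
  show ?thesis
    using very_few_zero_divisors_ascends very_few_zero_divisors_descends by blast
qed

end
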